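(* Let $A, B \subset \mathbb{R}^2$ be planar convex bodies with $A \subseteq B$, and let $\alpha \in \,]0,\tfrac12[$. Then there exists an $\alpha$-section of $A$ which is a $\beta$-section of $B$ for some $\beta \geq \alpha$.
   Context: A planar convex body is a compact convex subset of $\mathbb{R}^2$ with nonempty interior; $|X|$ denotes area. For an oriented straight line $\Delta$ with direction $\theta$, i.e. oriented by $(\cos\theta,\sin\theta)$ and at signed distance $t$ from the origin, $\Delta^+ = \{x \in \mathbb{R}^2 : \langle x, (-\sin\theta,\cos\theta)\rangle \geq t\}$ is the closed half-plane on its left and $\Delta^-$ the closed half-plane on its right. For $\gamma \in \,]0,1[$ and a planar convex body $K$, a $\gamma$-section of $K$ is an oriented line $\Delta$ with $|\Delta^- \cap K| = \gamma |K|$. *)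

theory Defs
  imports "HOL-Analysis.Analysis"
begin

definition planar_convex_body :: "(real^2) set \<Rightarrow> bool" where
  "planar_convex_body K \<longleftrightarrow> compact K \<and> convex K \<and> interior K \<noteq> {}"

definition area :: "(real^2) set \<Rightarrow> real" where
  "area X = measure lebesgue X"

text \<open>Left normal of the oriented direction (cos theta, sin theta).\<close>
definition lnormal :: "real \<Rightarrow> real^2" where
  "lnormal \<theta> = vector [- sin \<theta>, cos \<theta>]"

text \<open>Closed half-planes to the left (plus) and right (minus) of the oriented line
  with direction theta at signed distance t from the origin.\<close>
definition half_plus :: "real \<Rightarrow> real \<Rightarrow> (real^2) set" where
  "half_plus \<theta> t = {x. inner x (lnormal \<theta>) \<ge> t}"

definition half_minus :: "real \<Rightarrow> real \<Rightarrow> (real^2) set" where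
  "half_minus \<theta> t = {x. inner x (lnormal \<theta>) \<le> t}"

definition is_section :: "real \<Rightarrow> (real^2) set \<Rightarrow> real \<Rightarrow> real \<Rightarrow> bool" where
  "is_section \<gamma> K \<theta> t \<longleftrightarrow> 0 < \<gamma> \<and> \<gamma> < 1 \<and> area (half_minus \<theta> t \<inter> K) = \<gamma> * area K"

end

(*
Cut A by a chain of chords, each cutting off a cap of area alpha |A| to its right and starting at
the point of the boundary of A where the previous one ends.  Suppose that n chords of the chain
wind around A about w times.
A point outside A lies to the right of at least about w of the n lines, because the chords of one
lap bound a convex region contained in A.
A point inside A lies in at most about w of the n caps: caps with a common point overlap, and since
alpha < 1/2 consecutive caps do not, so Katona's cycle argument (as in his proof of the
Erdos-Ko-Rado theorem) applies.
Integrating the second bound over A gives alpha <= w / n up to O(1/n); integrating the first one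
over B - A then shows that on average the lines cut off at least about alpha |B - A| from B - A.
As n grows, compactness gives one line of the family cutting off at least alpha |B| from B.
*)

theory Submission
  imports Defs
begin

section \<open>Unit normals of oriented directions\<close>

lemma inner_lnormal: "inner x (lnormal \<theta>) = cos \<theta> * x $ 2 - sin \<theta> * x $ 1"
  by (simp add: lnormal_def inner_vec_def sum_2 algebra_simps)

lemma lnormal_inner_self: "inner (lnormal \<theta>) (lnormal \<theta>) = 1"
  by (simp add: inner_lnormal) (simp add: lnormal_def flip: power2_eq_square)

lemma lnormal_nonzero: "lnormal \<theta> \<noteq> 0"
  using lnormal_inner_self[of \<theta>] by auto

lemma lnormal_add_pi: "lnormal (\<theta> + pi) = - lnormal \<theta>"
  by (simp add: lnormal_def vec_eq_iff forall_2)

lemma lnormal_add_2pi_int: "lnormal (\<theta> + 2 * pi * of_int m) = lnormal \<theta>"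
proof -
  have "sin (\<theta> + 2 * pi * of_int m) = sin \<theta>" "cos (\<theta> + 2 * pi * of_int m) = cos \<theta>"
    by (simp_all add: sin_add cos_add sin_int_2pin cos_int_2pin)
  then show ?thesis
    by (simp add: lnormal_def)
qed

lemma continuous_lnormal: "continuous_on UNIV lnormal"
proof -
  have eq: "lnormal = (\<lambda>\<theta>. (- sin \<theta>) *\<^sub>R axis 1 1 + cos \<theta> *\<^sub>R axis 2 1)"
    by (auto simp: lnormal_def vec_eq_iff forall_2 axis_def fun_eq_iff)
  show ?thesis
    unfolding eq by (intro continuous_intros)
qed

lemma exists_lnormal:
  fixes a :: "real^2"
  assumes "a \<noteq> 0"
  obtains \<theta> where "a = norm a *\<^sub>R lnormal \<theta>"
proof -
  let ?r = "norm a"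
  have r: "?r > 0"
    using assms by simp
  have r2: "?r^2 = (a$1)^2 + (a$2)^2"
    by (simp add: norm_vec_def L2_set_def sum_2)
  have "(a$2 / ?r)^2 + (- a$1 / ?r)^2 = ((a$1)^2 + (a$2)^2) / ?r^2"
    by (simp add: power_divide add_divide_distrib)
  also have "\<dots> = 1"
    unfolding r2[symmetric] using r by simp
  finally obtain \<theta> where \<theta>: "a$2 / ?r = cos \<theta>" "- a$1 / ?r = sin \<theta>"
    by (rule sincos_total_2pi)
  have "a$1 = - (?r * sin \<theta>)" "a$2 = ?r * cos \<theta>"
    using r by (simp_all flip: \<theta>)
  then have "a = ?r *\<^sub>R lnormal \<theta>"
    unfolding vec_eq_iff forall_2 by (simp add: lnormal_def)
  then show ?thesis
    by (rule that)
qed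

text \<open>For \<theta> < \<phi> < \<theta> + pi and \<psi> between them, this makes the middle
  normal a nonnegative combination of the outer ones; later comparisons of three directions rest on
  these signs.\<close>

lemma inner_lnormal_between:
  "sin (\<phi> - \<psi>) * inner x (lnormal \<theta>) + sin (\<psi> - \<theta>) * inner x (lnormal \<phi>)
    = sin (\<phi> - \<theta>) * inner x (lnormal \<psi>)"
  by (simp add: inner_lnormal sin_diff algebra_simps)

section \<open>Areas of half-plane cuts and double counting\<close>

lemma half_minus_eq_halfspace: "half_minus \<theta> s = {x. inner (lnormal \<theta>) x \<le> s}"
  by (simp add: half_minus_def inner_commute)

lemma closed_half_minus: "closed (half_minus \<theta> s)"
  by (simp add: half_minus_eq_halfspace closed_halfspace_le)

lemma negligible_line: "negligible {x. inner x (lnormal \<theta>) = s}"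
  using negligible_hyperplane[of "lnormal \<theta>" s] lnormal_nonzero by (simp add: inner_commute)

lemma half_minus_lmeasurable:
  assumes "K \<in> lmeasurable"
  shows "half_minus \<theta> s \<inter> K \<in> lmeasurable"
  using assms closed_half_minus
  by (metis fmeasurable_Int_fmeasurable inf_commute lebesgue_closedin sets_lebesgue_on_refl
      borel_closed sets_completionI_sets sets_lborel)

text \<open>The indicator functions converge off the limit line, which is a null set, and the
  indicator of \<open>K\<close> dominates them.\<close>

lemma area_half_minus_tendsto:
  assumes K: "K \<in> lmeasurable" and \<phi>: "\<phi> \<longlonglongrightarrow> \<theta>" and r: "r \<longlonglongrightarrow> s"
  shows "(\<lambda>k. area (half_minus (\<phi> k) (r k) \<inter> K)) \<longlonglongrightarrow> area (half_minus \<theta> s \<inter> K)"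
proof -
  let ?f = "\<lambda>k. indicat_real (half_minus (\<phi> k) (r k) \<inter> K)"
  let ?g = "indicat_real (half_minus \<theta> s \<inter> K)"
  have n: "(\<lambda>k. lnormal (\<phi> k)) \<longlonglongrightarrow> lnormal \<theta>"
    using continuous_lnormal \<phi>
    by (simp add: continuous_on_eq_continuous_at isCont_tendsto_compose)
  have lim: "(\<lambda>k. ?f k x) \<longlonglongrightarrow> ?g x" if x: "inner x (lnormal \<theta>) \<noteq> s" for x
  proof -
    have lim0: "(\<lambda>k. inner x (lnormal (\<phi> k)) - r k) \<longlonglongrightarrow> inner x (lnormal \<theta>) - s"
      by (intro tendsto_intros n r)
    have "\<forall>\<^sub>F k in sequentially. ?f k x = ?g x"
    proof (cases "inner x (lnormal \<theta>) < s")
      case True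
      then have "\<forall>\<^sub>F k in sequentially. inner x (lnormal (\<phi> k)) - r k < 0"
        by (intro order_tendstoD(2)[OF lim0]) simp
      then show ?thesis
        by eventually_elim (use True in \<open>auto simp: half_minus_def indicator_def\<close>)
    next
      case False
      then have "\<forall>\<^sub>F k in sequentially. inner x (lnormal (\<phi> k)) - r k > 0"
        using x by (intro order_tendstoD(1)[OF lim0]) simp
      then show ?thesis
        by eventually_elim (use False x in \<open>auto simp: half_minus_def indicator_def\<close>)
    qed
    then show ?thesis
      by (rule tendsto_eventually)
  qed
  have "AE x in lebesgue. inner x (lnormal \<theta>) \<noteq> s"
    using AE_not_in[of "{x. inner x (lnormal \<theta>) = s}" lebesgue] negligible_line[of \<theta> s]
    by (simp add: negligible_iff_null_sets)
  then have ae: "AE x in lebesgue. (\<lambda>k. ?f k x) \<longlonglongrightarrow> ?g x"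
    by eventually_elim (rule lim)
  have "(\<lambda>k. integral\<^sup>L lebesgue (?f k)) \<longlonglongrightarrow> integral\<^sup>L lebesgue ?g"
  proof (rule integral_dominated_convergence[where w = "indicat_real K"])
    show "?g \<in> borel_measurable lebesgue" "?f k \<in> borel_measurable lebesgue" for k
      using half_minus_lmeasurable[OF K] by (auto intro!: borel_measurable_indicator)
    show "integrable lebesgue (indicat_real K)"
      using K by (simp add: lmeasurable_iff_integrable)
    show "AE x in lebesgue. norm (?f k x) \<le> indicat_real K x" for k
      by (auto simp: indicator_def)
  qed (rule ae)
  then show ?thesis
    by (simp add: area_def)
qed

lemma area_pos_of_open:
  assumes "open U" "U \<noteq> {}" "U \<subseteq> X" "X \<in> lmeasurable"
  shows "0 < area X"
proof -
  have "\<not> negligible X"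
    using assms open_not_negligible negligible_subset by blast
  then show ?thesis
    using assms(4) by (simp add: area_def negligible_iff_measure zero_less_measure_iff)
qed

lemma area_Diff:
  assumes "X \<in> lmeasurable" "Y \<in> lmeasurable" "Y \<subseteq> X"
  shows "area (X - Y) = area X - area Y"
  unfolding area_def using assms by (intro measurable_measure_Diff) (auto simp: fmeasurableD)

text \<open>Serves to pass between open and closed caps, and between a body and its interior, at no
  cost in area.\<close>

lemma area_le_of_negligible_diff:
  assumes "X \<in> lmeasurable" "Y \<in> lmeasurable" "X \<subseteq> Y \<union> N" "negligible N"
  shows "area X \<le> area Y"
proof -
  have N: "N \<in> lmeasurable" "measure lebesgue N = 0"
    using assms(4) by (auto simp: negligible_iff_measure)
  have "measure lebesgue X \<le> measure lebesgue (Y \<union> N)"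
    using assms N by (intro measure_mono_fmeasurable) auto
  also have "\<dots> \<le> measure lebesgue Y"
    using measure_Un_le[of Y lebesgue N] assms N by auto
  finally show ?thesis
    by (simp add: area_def)
qed

text \<open>Double counting: the sum is the integral of the number of sets \<open>X j\<close> that
  contain \<open>y\<close>.\<close>

lemma sum_area_le:
  assumes J: "finite J" and X: "\<And>j. j \<in> J \<Longrightarrow> X j \<in> lmeasurable" "\<And>j. j \<in> J \<Longrightarrow> X j \<subseteq> Y"
    and Y: "Y \<in> lmeasurable" and c: "\<And>y. y \<in> Y \<Longrightarrow> real (card {j\<in>J. y \<in> X j}) \<le> c"
  shows "(\<Sum>j\<in>J. area (X j)) \<le> c * area Y"
proof -
  have "(\<Sum>j\<in>J. area (X j)) = integral\<^sup>L lebesgue (\<lambda>y. \<Sum>j\<in>J. indicat_real (X j) y)"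
    using X by (subst Bochner_Integration.integral_sum)
      (auto simp: area_def lmeasurable_iff_integrable[symmetric])
  also have "\<dots> \<le> integral\<^sup>L lebesgue (\<lambda>y. c * indicat_real Y y)"
  proof (rule integral_mono)
    show "integrable lebesgue (\<lambda>y. \<Sum>j\<in>J. indicat_real (X j) y)"
      using X by (auto simp: lmeasurable_iff_integrable[symmetric])
    show "integrable lebesgue (\<lambda>y. c * indicat_real Y y)"
      using Y by (auto simp: lmeasurable_iff_integrable[symmetric])
    show "(\<Sum>j\<in>J. indicat_real (X j) y) \<le> c * indicat_real Y y" for y
    proof (cases "y \<in> Y")
      case True
      then show ?thesis
        using c[OF True] J by (simp add: indicator_def sum.If_cases Int_def)
    next
      case False
      then show ?thesis
        using X(2) by (intro sum_nonpos[THEN order_trans]) (auto simp: indicator_def)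
    qed
  qed
  finally show ?thesis
    by (simp add: area_def)
qed

text \<open>The same integral bounded from below; points of the sets outside \<open>Y\<close> only
  add to it.\<close>

lemma sum_area_ge:
  assumes J: "finite J" and X: "\<And>j. j \<in> J \<Longrightarrow> X j \<in> lmeasurable"
    and Y: "Y \<in> lmeasurable" and c: "\<And>y. y \<in> Y \<Longrightarrow> c \<le> real (card {j\<in>J. y \<in> X j})"
  shows "c * area Y \<le> (\<Sum>j\<in>J. area (X j))"
proof -
  have "c * area Y = integral\<^sup>L lebesgue (\<lambda>y. c * indicat_real Y y)"
    by (simp add: area_def)
  also have "\<dots> \<le> integral\<^sup>L lebesgue (\<lambda>y. \<Sum>j\<in>J. indicat_real (X j) y)"
  proof (rule integral_mono)
    show "integrable lebesgue (\<lambda>y. \<Sum>j\<in>J. indicat_real (X j) y)"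
      using X by (auto simp: lmeasurable_iff_integrable[symmetric])
    show "integrable lebesgue (\<lambda>y. c * indicat_real Y y)"
      using Y by (auto simp: lmeasurable_iff_integrable[symmetric])
    show "c * indicat_real Y y \<le> (\<Sum>j\<in>J. indicat_real (X j) y)" for y
      using c[of y] J by (cases "y \<in> Y") (simp_all add: indicator_def sum.If_cases Int_def)
  qed
  also have "\<dots> = (\<Sum>j\<in>J. area (X j))"
    using X by (subst Bochner_Integration.integral_sum)
      (auto simp: area_def lmeasurable_iff_integrable[symmetric])
  finally show ?thesis .
qed

section \<open>Convex bodies cut by parallel lines\<close>

lemma planar_convex_bodyD:
  assumes "planar_convex_body K"
  shows "compact K" "convex K" "interior K \<noteq> {}" "K \<in> lmeasurable" "0 < area K"
    "negligible (K - interior K)"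
proof -
  show K: "compact K" "convex K" "interior K \<noteq> {}"
    using assms by (auto simp: planar_convex_body_def)
  show m: "K \<in> lmeasurable"
    using K(1) by (rule lmeasurable_compact)
  show "0 < area K"
    using area_pos_of_open[OF open_interior K(3) interior_subset m] .
  show "negligible (K - interior K)"
    using negligible_convex_frontier[OF K(2)] negligible_subset
    by (metis Diff_mono closure_subset frontier_def order_refl)
qed

lemma area_half_minus_mono:
  assumes "K \<in> lmeasurable" "s \<le> s'"
  shows "area (half_minus \<theta> s \<inter> K) \<le> area (half_minus \<theta> s' \<inter> K)"
  unfolding area_def
  by (rule measure_mono_fmeasurable)
    (use assms half_minus_lmeasurable in \<open>auto simp: half_minus_def fmeasurableD\<close>)

text \<open>By \<open>pos\<close>, the interior of \<open>K\<close> has points on both sides of the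
  strip between the two lines. Being connected, it meets the open strip in a nonempty open set,
  which has positive area.\<close>

lemma area_half_minus_strict_mono:
  assumes K: "planar_convex_body K" and s: "s < s'"
    and pos: "0 < area (half_minus \<theta> s \<inter> K)" "area (half_minus \<theta> s' \<inter> K) < area K"
  shows "area (half_minus \<theta> s \<inter> K) < area (half_minus \<theta> s' \<inter> K)"
proof -
  note K' = planar_convex_bodyD[OF K]
  note meas = half_minus_lmeasurable[OF K'(4)]
  let ?f = "\<lambda>x. inner x (lnormal \<theta>)"
  have "\<exists>p\<in>interior K. ?f p \<le> s"
  proof (rule ccontr)
    assume *: "\<not> ?thesis"
    have "area (half_minus \<theta> s \<inter> K) \<le> area {}"
      by (rule area_le_of_negligible_diff[OF meas _ _ K'(6)])
        (use * in \<open>auto simp: half_minus_def\<close>)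
    then show False
      using pos by (simp add: area_def)
  qed
  then obtain p where p: "p \<in> interior K" "?f p \<le> s"
    by blast
  have "\<exists>q\<in>interior K. s' < ?f q"
  proof (rule ccontr)
    assume *: "\<not> ?thesis"
    have "area K \<le> area (half_minus \<theta> s' \<inter> K)"
      by (rule area_le_of_negligible_diff[OF K'(4) meas _ K'(6)])
        (use * in \<open>auto simp: half_minus_def not_less\<close>)
    then show False
      using pos by simp
  qed
  then obtain q where q: "q \<in> interior K" "s' < ?f q"
    by blast
  let ?U = "interior K \<inter> {x. s < ?f x} \<inter> {x. ?f x < s'}"
  have "connected (interior K)"
    using K'(2) convex_interior convex_connected by blast
  then obtain x where "x \<in> interior K" "?f x = (s + s') / 2"
    using connected_ivt_hyperplane[of "interior K" p q "lnormal \<theta>" "(s + s') / 2"] p q s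
    by (auto simp: inner_commute)
  then have "?U \<noteq> {}"
    using s by force
  moreover have "open ?U"
    using open_halfspace_gt[of s "lnormal \<theta>"] open_halfspace_lt[of "lnormal \<theta>" s']
    by (intro open_Int) (auto simp: inner_commute)
  moreover have "?U \<subseteq> (half_minus \<theta> s' \<inter> K) - (half_minus \<theta> s \<inter> K)"
    using interior_subset[of K] by (auto simp: half_minus_def)
  ultimately have "0 < area ((half_minus \<theta> s' \<inter> K) - (half_minus \<theta> s \<inter> K))"
    by (blast intro: area_pos_of_open fmeasurable.Diff meas)
  moreover have "half_minus \<theta> s \<inter> K \<subseteq> half_minus \<theta> s' \<inter> K"
    using s by (auto simp: half_minus_def)
  ultimately show ?thesis
    by (simp add: area_Diff meas)
qed

text \<open>As the line sweeps across \<open>K\<close>, the area cut off grows continuously from 0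
  to \<open>area K\<close>.\<close>

lemma exists_section:
  assumes K: "planar_convex_body K" and \<gamma>: "0 < \<gamma>" "\<gamma> < 1"
  shows "\<exists>s. area (half_minus \<theta> s \<inter> K) = \<gamma> * area K"
proof -
  note K' = planar_convex_bodyD[OF K]
  let ?F = "\<lambda>s. area (half_minus \<theta> s \<inter> K)"
  obtain R where R: "\<And>x. x \<in> K \<Longrightarrow> norm x \<le> R"
    using compact_imp_bounded[OF K'(1)] unfolding bounded_iff by blast
  have R': "\<bar>inner x (lnormal \<theta>)\<bar> \<le> R" if "x \<in> K" for x
    using Cauchy_Schwarz_ineq2[of x "lnormal \<theta>"] R[OF that] lnormal_inner_self[of \<theta>]
    by (simp add: norm_eq_sqrt_inner)
  have R0: "0 \<le> R"
    using R' K'(3) interior_subset by fastforce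
  have "half_minus \<theta> (- R - 1) \<inter> K = {}" "half_minus \<theta> R \<inter> K = K"
    using R' by (force simp: half_minus_def)+
  then have "?F (- R - 1) = 0" "?F R = area K"
    by (simp_all add: area_def)
  moreover have "continuous_on UNIV ?F"
    by (auto simp: continuous_on_sequentially comp_def intro: area_half_minus_tendsto[OF K'(4)])
  ultimately have "\<exists>s\<ge>- R - 1. s \<le> R \<and> ?F s = \<gamma> * area K"
    using \<gamma> K'(5) R0 by (intro IVT') (auto intro: continuous_on_subset)
  then show ?thesis
    by blast
qed


section \<open>The caps of area \<open>\<alpha> * area A\<close>\<close>

locale equal_area_caps =
  fixes A :: "(real^2) set" and \<alpha> :: real and t :: "real \<Rightarrow> real"
  assumes A: "planar_convex_body A" and \<alpha>: "0 < \<alpha>" "\<alpha> < 1/2"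
    and t: "\<And>\<theta>. area (half_minus \<theta> (t \<theta>) \<inter> A) = \<alpha> * area A"
begin

text \<open>Signed distance of \<open>x\<close> from the line of the cap, negative on the side of
  the cap.\<close>

definition level :: "real \<Rightarrow> real^2 \<Rightarrow> real" where
  "level \<theta> x = inner x (lnormal \<theta>) - t \<theta>"

text \<open>Open half-planes and the interior are used so that caps which merely touch do not meet.
  Not meeting then survives limits of directions.\<close>

definition caps_meet :: "real \<Rightarrow> real \<Rightarrow> bool" where
  "caps_meet \<theta> \<phi> \<longleftrightarrow> (\<exists>y\<in>interior A. level \<theta> y < 0 \<and> level \<phi> y < 0)"

lemmas A_facts = planar_convex_bodyD[OF A]

lemma mem_half_minus: "x \<in> half_minus \<theta> (t \<theta>) \<longleftrightarrow> level \<theta> x \<le> 0"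
  by (simp add: half_minus_def level_def)

lemma cap_area_bounds: "0 < \<alpha> * area A" "2 * (\<alpha> * area A) < area A" "\<alpha> * area A < area A"
  using \<alpha> A_facts(5) by simp_all

text \<open>Strict monotonicity pins \<open>t \<theta>\<close> down by areas alone; continuity and
  periodicity of \<open>t\<close> are read off from this.\<close>

lemma t_less_iff: "s < t \<theta> \<longleftrightarrow> area (half_minus \<theta> s \<inter> A) < \<alpha> * area A" (is ?less)
  and t_greater_iff: "t \<theta> < s \<longleftrightarrow> \<alpha> * area A < area (half_minus \<theta> s \<inter> A)" (is ?greater)
proof -
  note mono = area_half_minus_mono[OF A_facts(4)]
  have 1: "area (half_minus \<theta> s \<inter> A) < \<alpha> * area A" if "s < t \<theta>"
  proof (rule ccontr)
    assume *: "\<not> ?thesis"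
    have "area (half_minus \<theta> s \<inter> A) < area (half_minus \<theta> (t \<theta>) \<inter> A)"
      using * cap_area_bounds t by (intro area_half_minus_strict_mono[OF A that]) auto
    then show False
      using * t by simp
  qed
  have 2: "\<alpha> * area A < area (half_minus \<theta> s \<inter> A)" if "t \<theta> < s"
  proof (rule ccontr)
    assume *: "\<not> ?thesis"
    have "area (half_minus \<theta> (t \<theta>) \<inter> A) < area (half_minus \<theta> s \<inter> A)"
      using * cap_area_bounds t by (intro area_half_minus_strict_mono[OF A that]) auto
    then show False
      using * t by simp
  qed
  show ?less ?greater
    using 1 2 mono[of s "t \<theta>" \<theta>] mono[of "t \<theta>" s \<theta>] t[of \<theta>] by linarith+
qed

lemma continuous_t: "continuous_on UNIV t"
proof -
  have "(\<lambda>k. t (\<phi> k)) \<longlonglongrightarrow> t \<theta>" if \<phi>: "\<phi> \<longlonglongrightarrow> \<theta>" for \<phi> \<theta>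
  proof (rule order_tendstoI)
    have lim: "(\<lambda>k. area (half_minus (\<phi> k) s \<inter> A)) \<longlonglongrightarrow> area (half_minus \<theta> s \<inter> A)" for s
      by (rule area_half_minus_tendsto[OF A_facts(4) \<phi> tendsto_const])
    show "\<forall>\<^sub>F k in sequentially. s < t (\<phi> k)" if "s < t \<theta>" for s
      using order_tendstoD(2)[OF lim] that by (simp add: t_less_iff)
    show "\<forall>\<^sub>F k in sequentially. t (\<phi> k) < s" if "t \<theta> < s" for s
      using order_tendstoD(1)[OF lim] that by (simp add: t_greater_iff)
  qed
  then show ?thesis
    by (auto simp: continuous_on_sequentially comp_def)
qed

lemma level_tendsto:
  assumes "\<phi> \<longlonglongrightarrow> \<theta>" "x \<longlonglongrightarrow> y"
  shows "(\<lambda>k. level (\<phi> k) (x k)) \<longlonglongrightarrow> level \<theta> y"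
  unfolding level_def
  using continuous_t continuous_lnormal assms
  by (intro tendsto_intros) (simp_all add: continuous_on_eq_continuous_at isCont_tendsto_compose)

lemma t_periodic: "t (\<theta> + 2 * pi * of_int m) = t \<theta>"
proof -
  have "half_minus (\<theta> + 2 * pi * of_int m) s = half_minus \<theta> s" for s
    by (simp add: half_minus_def lnormal_add_2pi_int)
  then show ?thesis
    using t_less_iff[of _ \<theta>] t_less_iff[of _ "\<theta> + 2 * pi * of_int m"] by (metis less_irrefl linorder_neqE)
qed

lemma level_periodic: "level (\<theta> + 2 * pi * of_int m) = level \<theta>"
  by (simp add: level_def fun_eq_iff t_periodic lnormal_add_2pi_int)

text \<open>The sum does not depend on \<open>x\<close>. Were it nonpositive, the two opposite caps
  would cover \<open>A\<close>, against \<alpha> < 1/2.\<close>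

lemma opposite_level_pos: "0 < level \<theta> x + level (\<theta> + pi) x"
proof -
  have "t \<theta> + t (\<theta> + pi) < 0"
  proof (rule ccontr)
    assume *: "\<not> ?thesis"
    let ?X = "half_minus \<theta> (t \<theta>) \<inter> A" and ?Y = "half_minus (\<theta> + pi) (t (\<theta> + pi)) \<inter> A"
    have "A = ?X \<union> ?Y"
      using * by (auto simp: half_minus_def lnormal_add_pi)
    then have "area A \<le> area ?X + area ?Y"
      using measure_Un_le[of ?X lebesgue ?Y] half_minus_lmeasurable[OF A_facts(4)]
      by (simp add: area_def fmeasurableD)
    then show False
      using t cap_area_bounds by simp
  qed
  then show ?thesis
    by (simp add: level_def lnormal_add_pi)
qed

section \<open>Overlap of caps in two and three directions\<close>

lemma not_caps_meet_pi: "\<not> caps_meet \<theta> (\<theta> + pi)"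
proof
  assume "caps_meet \<theta> (\<theta> + pi)"
  then obtain y where "level \<theta> y < 0" "level (\<theta> + pi) y < 0"
    by (auto simp: caps_meet_def)
  then show False
    using opposite_level_pos[of \<theta> y] by simp
qed

text \<open>Otherwise the cap would lie in the union of its line and \<open>A - interior A\<close>,
  a null set.\<close>

lemma exists_cap_point: "\<exists>y\<in>interior A. level \<theta> y < 0"
proof (rule ccontr)
  assume *: "\<not> ?thesis"
  have "area (half_minus \<theta> (t \<theta>) \<inter> A) \<le> area {}"
  proof (rule area_le_of_negligible_diff)
    show "negligible ((A - interior A) \<union> {x. inner x (lnormal \<theta>) = t \<theta>})"
      using A_facts(6) negligible_line by (rule negligible_Un)
    show "half_minus \<theta> (t \<theta>) \<inter> A \<subseteq> {} \<union> ((A - interior A) \<union> {x. inner x (lnormal \<theta>) = t \<theta>})"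
      using * by (force simp: half_minus_def level_def)
  qed (auto intro: half_minus_lmeasurable A_facts)
  then show False
    using t cap_area_bounds by (simp add: area_def)
qed

lemma caps_meet_refl: "caps_meet \<theta> \<theta>"
  using exists_cap_point by (auto simp: caps_meet_def)

text \<open>Without such a \<open>q\<close>, the cap of \<phi> would lie in that of \<theta> up to a
  null set. Near \<open>p\<close>, however, an open piece of the cap of \<theta> lies outside the
  cap of \<phi>, so the areas would differ.\<close>

lemma exchange:
  assumes p: "p \<in> interior A" "level \<theta> p < 0" "0 \<le> level \<phi> p"
  shows "\<exists>q\<in>interior A. level \<phi> q < 0 \<and> 0 \<le> level \<theta> q"
proof (rule ccontr)
  assume *: "\<not> ?thesis"
  let ?X = "half_minus \<theta> (t \<theta>) \<inter> A" and ?Y = "half_minus \<phi> (t \<phi>) \<inter> A"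
  let ?N = "(A - interior A) \<union> {x. inner x (lnormal \<phi>) = t \<phi>}"
  note meas = half_minus_lmeasurable[OF A_facts(4)]
  have "area ?Y \<le> area (?X \<inter> ?Y)"
  proof (rule area_le_of_negligible_diff)
    show "negligible ?N"
      using A_facts(6) negligible_line by (rule negligible_Un)
    show "?Y \<subseteq> (?X \<inter> ?Y) \<union> ?N"
      using * by (force simp: half_minus_def level_def)
  qed (auto intro: meas fmeasurable.Int)
  let ?U = "interior A \<inter> {x. level \<theta> x < 0} \<inter> {x. 0 < level \<phi> x}"
  have "?U \<noteq> {}"
  proof -
    \<comment> \<open>\<open>p\<close> may lie on the line of direction \<phi>; a small shift along
      the normal moves it strictly to the left, within the interior and the cap of \<theta>.\<close>
    have lim: "(\<lambda>n. p + inverse (of_nat (Suc n)) *\<^sub>R lnormal \<phi>) \<longlonglongrightarrow> p + 0 *\<^sub>R lnormal \<phi>"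
      by (intro tendsto_intros LIMSEQ_inverse_real_of_nat)
    then have lim: "(\<lambda>n. p + inverse (of_nat (Suc n)) *\<^sub>R lnormal \<phi>) \<longlonglongrightarrow> p"
      by simp
    have "\<forall>\<^sub>F n in sequentially. p + inverse (of_nat (Suc n)) *\<^sub>R lnormal \<phi> \<in> interior A"
      using topological_tendstoD[OF lim] p by blast
    moreover have "\<forall>\<^sub>F n in sequentially. level \<theta> (p + inverse (of_nat (Suc n)) *\<^sub>R lnormal \<phi>) < 0"
      using order_tendstoD(2)[OF level_tendsto[OF tendsto_const lim]] p by blast
    ultimately have "\<forall>\<^sub>F n in sequentially. p + inverse (of_nat (Suc n)) *\<^sub>R lnormal \<phi> \<in> ?U"
    proof eventually_elim
      case (elim n)
      have "0 < level \<phi> (p + e *\<^sub>R lnormal \<phi>)" if "0 < e" for e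
        using that p by (simp add: level_def inner_add_left lnormal_inner_self)
      then have "0 < level \<phi> (p + inverse (of_nat (Suc n)) *\<^sub>R lnormal \<phi>)"
        by simp
      then show ?case
        using elim by simp
    qed
    then show ?thesis
      by (auto dest: eventually_happens)
  qed
  moreover have "open ?U"
    using open_halfspace_gt[of "t \<phi>" "lnormal \<phi>"] open_halfspace_lt[of "lnormal \<theta>" "t \<theta>"]
    by (intro open_Int) (auto simp: inner_commute level_def)
  moreover have "?U \<subseteq> ?X - (?X \<inter> ?Y)"
    using interior_subset[of A] by (auto simp: half_minus_def level_def)
  ultimately have "0 < area (?X - (?X \<inter> ?Y))"
    by (blast intro: area_pos_of_open fmeasurable.Diff fmeasurable.Int meas)
  then have "area (?X \<inter> ?Y) < area ?X"
    by (subst (asm) area_Diff) (auto intro: meas fmeasurable.Int)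
  then show False
    using \<open>area ?Y \<le> _\<close> t by simp
qed

text \<open>The offsets cancel in differences of levels, so the relation between the normals carries
  over.\<close>

lemma level_between:
  "sin (\<phi> - \<psi>) * (level \<theta> x - level \<theta> y) + sin (\<psi> - \<theta>) * (level \<phi> x - level \<phi> y)
    = sin (\<phi> - \<theta>) * (level \<psi> x - level \<psi> y)"
  using inner_lnormal_between[of \<phi> \<psi> "x - y" \<theta>] by (simp add: level_def inner_diff_left)

text \<open>If \<open>p\<close> lies in the two outer caps but not in the middle one, and \<open>q\<close> in the middle one
  only, the two sides of \<open>level_between\<close> have opposite signs; \<open>q\<close> exists because the caps
  have equal area.\<close>

lemma caps_meet_between:
  assumes "\<theta> < \<psi>" "\<psi> < \<phi>" "\<phi> < \<theta> + pi" "caps_meet \<theta> \<phi>"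
  shows "caps_meet \<theta> \<psi> \<and> caps_meet \<psi> \<phi>"
proof (rule ccontr)
  assume *: "\<not> ?thesis"
  obtain p where p: "p \<in> interior A" "level \<theta> p < 0" "level \<phi> p < 0"
    using assms(4) by (auto simp: caps_meet_def)
  have p\<psi>: "0 \<le> level \<psi> p"
    using * p by (force simp: caps_meet_def)
  have "\<exists>q\<in>interior A. level \<psi> q < 0 \<and> 0 \<le> level \<theta> q \<and> 0 \<le> level \<phi> q"
    using exchange[OF p(1,2) p\<psi>] exchange[OF p(1,3) p\<psi>] * by (force simp: caps_meet_def)
  then obtain q where q: "level \<psi> q < 0" "0 \<le> level \<theta> q" "0 \<le> level \<phi> q"
    by blast
  have "0 < sin (\<phi> - \<psi>)" "0 < sin (\<psi> - \<theta>)" "0 < sin (\<phi> - \<theta>)"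
    using assms by (auto intro!: sin_gt_zero)
  then have "sin (\<phi> - \<psi>) * (level \<theta> p - level \<theta> q) + sin (\<psi> - \<theta>) * (level \<phi> p - level \<phi> q) < 0"
    "0 < sin (\<phi> - \<theta>) * (level \<psi> p - level \<psi> q)"
    using p p\<psi> q by (auto intro!: add_neg_neg mult_pos_neg)
  then show False
    using level_between[of \<phi> \<psi> \<theta> p q] by simp
qed

section \<open>The next direction of the chain\<close>

text \<open>The line in direction \<open>succ_dir \<theta>\<close> enters \<open>A\<close> where the line in direction \<open>\<theta>\<close> leaves
  it: this is the first direction whose cap no longer overlaps the cap of \<open>\<theta>\<close>.\<close>

definition succ_dir :: "real \<Rightarrow> real" where
  "succ_dir \<theta> = Inf {\<phi>. \<theta> \<le> \<phi> \<and> \<not> caps_meet \<theta> \<phi>}"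

lemma succ_dir_lower: "\<theta> \<le> \<phi> \<Longrightarrow> \<not> caps_meet \<theta> \<phi> \<Longrightarrow> succ_dir \<theta> \<le> \<phi>"
  unfolding succ_dir_def by (intro cInf_lower bdd_belowI[of _ \<theta>]) auto

lemma succ_dir_bounds_weak: "\<theta> \<le> succ_dir \<theta>" "succ_dir \<theta> \<le> \<theta> + pi"
proof -
  show "\<theta> \<le> succ_dir \<theta>"
    unfolding succ_dir_def
    by (rule cInf_greatest) (use not_caps_meet_pi[of \<theta>] in \<open>auto intro!: exI[of _ "\<theta> + pi"]\<close>)
  show "succ_dir \<theta> \<le> \<theta> + pi"
    by (rule succ_dir_lower) (simp_all add: not_caps_meet_pi)
qed

text \<open>A common point of two open caps persists under small rotations, so the infimum is
  attained.\<close>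

lemma not_caps_meet_succ_dir: "\<not> caps_meet \<theta> (succ_dir \<theta>)"
proof
  assume "caps_meet \<theta> (succ_dir \<theta>)"
  then obtain y where y: "y \<in> interior A" "level \<theta> y < 0" "level (succ_dir \<theta>) y < 0"
    by (auto simp: caps_meet_def)
  let ?S = "{\<phi>. \<theta> \<le> \<phi> \<and> \<not> caps_meet \<theta> \<phi>}"
  have "succ_dir \<theta> \<in> closure ?S"
    unfolding succ_dir_def
    by (rule closure_contains_Inf)
      (use not_caps_meet_pi[of \<theta>] in \<open>auto intro!: bdd_belowI[of _ \<theta>] exI[of _ "\<theta> + pi"]\<close>)
  then obtain \<phi> where \<phi>: "\<And>k. \<phi> k \<in> ?S" "\<phi> \<longlonglongrightarrow> succ_dir \<theta>"
    by (auto simp: closure_sequential)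
  have "\<forall>\<^sub>F k in sequentially. level (\<phi> k) y < 0"
    using order_tendstoD(2)[OF level_tendsto[OF \<phi>(2) tendsto_const]] y by blast
  then obtain k where "level (\<phi> k) y < 0"
    by (auto dest: eventually_happens)
  then show False
    using \<phi>(1)[of k] y by (auto simp: caps_meet_def)
qed

lemma succ_dir_gt: "\<theta> < succ_dir \<theta>"
  using succ_dir_bounds_weak[of \<theta>] not_caps_meet_succ_dir[of \<theta>] caps_meet_refl[of \<theta>]
  by (metis less_eq_real_def)

text \<open>Directions slightly before \<open>succ_dir \<theta>\<close> still give overlapping caps;
  by compactness of \<open>A\<close> their common points accumulate.\<close>

lemma closed_caps_touch: "\<exists>x\<in>A. level \<theta> x \<le> 0 \<and> level (succ_dir \<theta>) x \<le> 0"
proof -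
  let ?\<phi> = "\<lambda>k. succ_dir \<theta> - (succ_dir \<theta> - \<theta>) * inverse (real (Suc k))"
  have \<phi>: "?\<phi> \<longlonglongrightarrow> succ_dir \<theta> - (succ_dir \<theta> - \<theta>) * 0"
    by (intro tendsto_intros LIMSEQ_inverse_real_of_nat)
  have "\<exists>y\<in>A. level \<theta> y \<le> 0 \<and> level (?\<phi> k) y \<le> 0" for k
  proof -
    have "inverse (real (Suc k)) \<le> 1"
      by (simp add: field_simps)
    then have "(succ_dir \<theta> - \<theta>) * inverse (real (Suc k)) \<le> (succ_dir \<theta> - \<theta>) * 1"
      using succ_dir_gt[of \<theta>] by (intro mult_left_mono) auto
    then have "\<theta> \<le> ?\<phi> k"
      by (simp only: mult_1_right le_diff_eq add.commute)
    moreover have "?\<phi> k < succ_dir \<theta>"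
      using succ_dir_gt[of \<theta>] by simp
    ultimately have "caps_meet \<theta> (?\<phi> k)"
      using succ_dir_lower by (meson linorder_not_less)
    then show ?thesis
      using interior_subset[of A] by (force simp: caps_meet_def)
  qed
  then obtain y where y: "\<And>k. y k \<in> A" "\<And>k. level \<theta> (y k) \<le> 0" "\<And>k. level (?\<phi> k) (y k) \<le> 0"
    by metis
  obtain x r where x: "x \<in> A" "strict_mono r" "(y \<circ> r) \<longlonglongrightarrow> x"
    using A_facts(1) y(1) unfolding compact_def by metis
  have "(\<lambda>k. level \<theta> ((y \<circ> r) k)) \<longlonglongrightarrow> level \<theta> x"
    by (rule level_tendsto[OF tendsto_const x(3)])
  then have "level \<theta> x \<le> 0"
    by (rule LIMSEQ_le_const2) (use y in auto)
  moreover have "(\<lambda>k. level ((?\<phi> \<circ> r) k) ((y \<circ> r) k)) \<longlonglongrightarrow> level (succ_dir \<theta>) x"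
    using \<phi> by (intro level_tendsto x(3) LIMSEQ_subseq_LIMSEQ[OF _ x(2)]) simp
  then have "level (succ_dir \<theta>) x \<le> 0"
    by (rule LIMSEQ_le_const2) (use y in auto)
  ultimately show ?thesis
    using x(1) by blast
qed

text \<open>At a half-turn, the touching point would contradict
  \<open>opposite_level_pos\<close>.\<close>

lemma succ_dir_less: "succ_dir \<theta> < \<theta> + pi"
  using succ_dir_bounds_weak(2)[of \<theta>] closed_caps_touch[of \<theta>] opposite_level_pos[of \<theta>]
  by (metis add_nonpos_nonpos less_eq_real_def not_less)

text \<open>If the caps met again later, \<open>caps_meet_between\<close> would make them meet at
  \<open>succ_dir \<theta>\<close> already.\<close>

lemma not_caps_meet_beyond_succ_dir:
  assumes "succ_dir \<theta> \<le> \<phi>" "\<phi> \<le> \<theta> + pi"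
  shows "\<not> caps_meet \<theta> \<phi>"
  using assms caps_meet_between[of \<theta> "succ_dir \<theta>" \<phi>] not_caps_meet_succ_dir[of \<theta>]
    not_caps_meet_pi[of \<theta>] succ_dir_gt[of \<theta>]
  by (metis less_eq_real_def)

text \<open>If the order were reversed, the cap of \<open>succ_dir \<psi>\<close> would overlap that
  of \<theta> and, by \<open>caps_meet_between\<close>, also that of \<psi>.\<close>

lemma succ_dir_mono: "\<theta> \<le> \<psi> \<Longrightarrow> succ_dir \<theta> \<le> succ_dir \<psi>"
proof (rule ccontr)
  assume *: "\<theta> \<le> \<psi>" "\<not> succ_dir \<theta> \<le> succ_dir \<psi>"
  then have "\<theta> < \<psi>"
    by (auto simp: less_le)
  have \<psi>: "\<psi> < succ_dir \<psi>" "succ_dir \<psi> < \<theta> + pi"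
    using * succ_dir_gt[of \<psi>] succ_dir_less[of \<theta>] by auto
  have "caps_meet \<theta> (succ_dir \<psi>)"
    using * \<psi> succ_dir_lower[of \<theta> "succ_dir \<psi>"] by linarith
  then show False
    using caps_meet_between[OF \<open>\<theta> < \<psi>\<close> \<psi>] not_caps_meet_succ_dir by blast
qed

section \<open>The chain and its caps over an inner point\<close>

text \<open>Angles are not reduced modulo a full turn, so \<open>dir n / (2 * pi)\<close> measures
  the turns made so far.\<close>

definition dir :: "nat \<Rightarrow> real" where
  "dir n = (succ_dir ^^ n) 0"

lemma dir_simps: "dir 0 = 0" "dir (Suc n) = succ_dir (dir n)"
  by (simp_all add: dir_def)

lemma mono_dir: "m \<le> n \<Longrightarrow> dir m \<le> dir n"
  by (rule lift_Suc_mono_le[of dir]) (auto simp: dir_simps less_imp_le succ_dir_gt)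

lemma dir_nonneg: "0 \<le> dir n"
  using mono_dir[of 0 n] by (simp add: dir_simps)

text \<open>Katona's cycle argument for a chain that need not close up: the caps containing \<open>y\<close> pairwise
  overlap, so, one of them being \<open>dir i\<close>, each interval of directions within \<open>pi\<close> of
  \<open>dir i + 2 * pi * m\<close> contains at most one of them.\<close>

lemma card_caps_inside:
  assumes y: "y \<in> interior A"
  shows "real (card {j\<in>{..n}. level (dir j) y < 0}) \<le> dir n / (2 * pi) + 2"
proof -
  let ?J = "{j\<in>{..n}. level (dir j) y < 0}"
  show ?thesis
  proof (cases "?J = {}")
    case True
    then show ?thesis
      unfolding True using dir_nonneg[of n] by simp
  next
    case False
    then obtain i where i: "i \<le> n" "level (dir i) y < 0"
      by auto
    \<comment> \<open>\<open>u j\<close> is the copy of \<open>dir i\<close> modulo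
      \<open>2 * pi\<close> whose window of half-width \<open>pi\<close>, open on the left and
      closed on the right, contains \<open>dir j\<close>.\<close>
    define lap where "lap j = \<lceil>(dir j - dir i - pi) / (2 * pi)\<rceil>" for j
    define u where "u j = dir i + 2 * pi * of_int (lap j)" for j
    have u: "u j - pi < dir j" "dir j \<le> u j + pi" for j
    proof -
      have "(dir j - dir i - pi) / (2 * pi) \<le> of_int (lap j)"
        "of_int (lap j) < (dir j - dir i - pi) / (2 * pi) + 1"
        unfolding lap_def by linarith+
      then show "u j - pi < dir j" "dir j \<le> u j + pi"
        by (simp_all add: u_def field_simps)
    qed
    have neq: "lap j \<noteq> lap j'" if j: "j \<in> ?J" "j' \<in> ?J" "j < j'" for j j'
    proof
      assume eq: "lap j = lap j'"
      \<comment> \<open>The caps of \<open>u j\<close> and \<open>dir j'\<close> share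
        \<open>y\<close>, and \<open>dir j'\<close> is at most \<open>pi\<close> beyond
        \<open>u j\<close>.\<close>
      have *: "succ_dir (u j) \<le> dir j' \<Longrightarrow> False"
      proof -
        assume "succ_dir (u j) \<le> dir j'"
        then have "\<not> caps_meet (u j) (dir j')"
          using u[of j'] eq by (intro not_caps_meet_beyond_succ_dir) (auto simp: u_def)
        then show False
          using y i j by (auto simp: caps_meet_def u_def level_periodic)
      qed
      have "dir (Suc j) \<le> dir j'"
        using j(3) by (intro mono_dir) simp
      show False
      proof (cases "u j \<le> dir j")
        case True
        then show False
          using * succ_dir_mono[OF True] \<open>dir (Suc j) \<le> dir j'\<close> by (simp add: dir_simps)
      next
        case False
        \<comment> \<open>Now \<open>u j\<close> lies after \<open>dir j\<close> but not after
          \<open>dir (Suc j)\<close>, so two steps of the chain are needed to pass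
          \<open>succ_dir (u j)\<close>. They are available because consecutive caps do not
          meet.\<close>
        have "caps_meet (dir j) (u j)"
          using y i j by (auto simp: caps_meet_def u_def level_periodic)
        then have "u j \<le> dir (Suc j)"
          using not_caps_meet_beyond_succ_dir[of "dir j" "u j"] u(1)[of j]
          by (force simp: dir_simps)
        then have 1: "succ_dir (u j) \<le> dir (Suc (Suc j))"
          using succ_dir_mono by (simp add: dir_simps)
        have "caps_meet (dir j) (dir j')"
          using y j by (auto simp: caps_meet_def)
        then have "j' \<noteq> Suc j"
          using not_caps_meet_succ_dir by (auto simp: dir_simps)
        then have "dir (Suc (Suc j)) \<le> dir j'"
          using j(3) by (intro mono_dir) simp
        then show False
          using 1 * by simp
      qed
    qed
    have "inj_on lap ?J"
      by (rule linorder_inj_onI) (use neq in \<open>force+\<close>)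
    \<comment> \<open>The bounds on \<open>lap\<close> come from \<open>0 \<le> dir j\<close> and
      \<open>dir j \<le> dir n\<close>. Counting both ends and rounding cost 1 each.\<close>
    let ?a = "(- dir i - pi) / (2 * pi)" and ?b = "(dir n - dir i - pi) / (2 * pi)"
    have "lap j \<in> {\<lceil>?a\<rceil>..\<lceil>?b\<rceil>}" if "j \<in> ?J" for j
      using that mono_dir[of j n] dir_nonneg[of j]
      by (auto simp: lap_def intro!: ceiling_mono divide_right_mono)
    then have "card ?J \<le> card {\<lceil>?a\<rceil>..\<lceil>?b\<rceil>}"
      using \<open>inj_on lap ?J\<close> by (intro card_inj_on_le[of lap]) auto
    also have "\<dots> = nat (\<lceil>?b\<rceil> + 1 - \<lceil>?a\<rceil>)"
      by simp
    finally have "real (card ?J) \<le> real (nat (\<lceil>?b\<rceil> + 1 - \<lceil>?a\<rceil>))"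
      by simp
    also have "?a \<le> ?b"
      using dir_nonneg[of n] by (intro divide_right_mono) auto
    then have "\<lceil>?a\<rceil> \<le> \<lceil>?b\<rceil>"
      by (rule ceiling_mono)
    then have "real (nat (\<lceil>?b\<rceil> + 1 - \<lceil>?a\<rceil>)) = of_int \<lceil>?b\<rceil> + 1 - of_int \<lceil>?a\<rceil>"
      by simp
    also have "\<dots> \<le> ?b - ?a + 2"
      by linarith
    also have "?b - ?a = dir n / (2 * pi)"
      by (simp add: diff_divide_distrib add_divide_distrib)
    finally show ?thesis .
  qed
qed

section \<open>The caps over an outer point\<close>

lemma exists_dir_interval:
  assumes "0 \<le> v" "v < dir n"
  shows "\<exists>j<n. dir j \<le> v \<and> v < dir (Suc j)"
  using assms by (induction n) (force simp: dir_simps(1) not_less less_Suc_eq)+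

text \<open>Take a direction \<psi> in which \<open>z\<close> lies to the right of all of
  \<open>A\<close>. Whenever the chain passes \<psi> modulo a full turn, \<open>z\<close> lies to
  the right of one of the two adjacent lines, and different passes yield different lines.\<close>

lemma card_caps_outside:
  assumes z: "z \<notin> A"
  shows "dir n / (2 * pi) - 1 \<le> real (card {j\<in>{..n}. level (dir j) z \<le> 0})"
proof -
  let ?J = "{j\<in>{..n}. level (dir j) z \<le> 0}"
  obtain a b where ab: "inner a z < b" "\<And>x. x \<in> A \<Longrightarrow> b < inner a x"
    using separating_hyperplane_closed_point[OF A_facts(2) compact_imp_closed[OF A_facts(1)] z] by auto
  then have "a \<noteq> 0"
    using A_facts(3) interior_subset by fastforce
  then obtain \<psi> where \<psi>: "a = norm a *\<^sub>R lnormal \<psi>"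
    by (rule exists_lnormal)
  have sep: "inner z (lnormal \<psi>) < inner x (lnormal \<psi>)" if "x \<in> A" for x
  proof -
    have "norm a * inner z (lnormal \<psi>) = inner a z" "norm a * inner x (lnormal \<psi>) = inner a x"
      by (subst (2) \<psi>, simp add: inner_commute)+
    then have "norm a * inner z (lnormal \<psi>) < norm a * inner x (lnormal \<psi>)"
      using ab that by force
    then show ?thesis
      by (rule mult_left_less_imp_less) simp
  qed
  define v where "v m = \<psi> + 2 * pi * of_int m" for m
  \<comment> \<open>The closed caps share a point \<open>x\<close> of \<open>A\<close>. If
    \<open>z\<close> were to the left of both lines, its level in the intermediate direction
    \<open>v m\<close> would be at least that of \<open>x\<close>, against
    \<open>sep\<close>.\<close>
  have cover: "level \<theta> z \<le> 0 \<or> level (succ_dir \<theta>) z \<le> 0"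
    if v: "\<theta> \<le> v m" "v m \<le> succ_dir \<theta>" for \<theta> m
  proof (rule ccontr)
    assume *: "\<not> ?thesis"
    obtain x where x: "x \<in> A" "level \<theta> x \<le> 0" "level (succ_dir \<theta>) x \<le> 0"
      using closed_caps_touch by blast
    let ?\<phi> = "succ_dir \<theta>"
    have "0 \<le> sin (?\<phi> - v m)" "0 \<le> sin (v m - \<theta>)" "0 < sin (?\<phi> - \<theta>)"
      using v succ_dir_gt[of \<theta>] succ_dir_less[of \<theta>] by (auto intro!: sin_ge_zero sin_gt_zero)
    then have "sin (?\<phi> - v m) * (level \<theta> x - level \<theta> z) + sin (v m - \<theta>) * (level ?\<phi> x - level ?\<phi> z) \<le> 0"
      "0 < sin (?\<phi> - \<theta>) * (level (v m) x - level (v m) z)"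
      using * x sep[OF x(1)]
      by (auto intro!: add_nonpos_nonpos mult_nonneg_nonpos mult_pos_pos
          simp: v_def level_def lnormal_add_2pi_int)
    then show False
      using level_between[of ?\<phi> "v m" \<theta> x z] by simp
  qed
  \<comment> \<open>The integers \<open>m\<close> with \<open>0 \<le> v m\<close> and
    \<open>v m < dir n\<close> run from the ceiling of \<open>?a\<close> to just below that of
    \<open>?b\<close>.\<close>
  let ?a = "- \<psi> / (2 * pi)" and ?b = "(dir n - \<psi>) / (2 * pi)"
  \<comment> \<open>\<open>h\<close> is either end of the step containing \<open>v m\<close>, and
    the stated window allows for both cases. For \<open>h = 0\<close> its left end is
    \<open>dir 0\<close>, as \<open>h - 1\<close> is then 0.\<close>
  have hit: "\<exists>h. h \<in> ?J \<and> dir (h - 1) \<le> v m \<and> v m < dir (Suc h)" if m: "m \<in> {\<lceil>?a\<rceil>..<\<lceil>?b\<rceil>}" for m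
  proof -
    have "?a \<le> of_int m" "of_int m < ?b"
      using m by (auto simp: ceiling_le_iff less_ceiling_iff)
    then have "0 \<le> v m" "v m < dir n"
      by (simp_all add: v_def field_simps)
    then obtain j where j: "j < n" "dir j \<le> v m" "v m < dir (Suc j)"
      using exists_dir_interval by blast
    then consider "level (dir j) z \<le> 0" | "level (dir (Suc j)) z \<le> 0"
      using cover[of "dir j" m] by (auto simp: dir_simps)
    then show ?thesis
    proof cases
      case 1
      then show ?thesis
        using j mono_dir[of "j - 1" j] by (intro exI[of _ j]) auto
    next
      case 2
      then show ?thesis
        using j mono_dir[of "Suc j" "Suc (Suc j)"] by (intro exI[of _ "Suc j"]) auto
    qed
  qed
  have "\<exists>h. \<forall>m\<in>{\<lceil>?a\<rceil>..<\<lceil>?b\<rceil>}. h m \<in> ?J \<and> dir (h m - 1) \<le> v m \<and> v m < dir (Suc (h m))"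
    by (intro bchoice ballI hit)
  then obtain h where h: "\<And>m. m \<in> {\<lceil>?a\<rceil>..<\<lceil>?b\<rceil>} \<Longrightarrow>
      h m \<in> ?J \<and> dir (h m - 1) \<le> v m \<and> v m < dir (Suc (h m))"
    by blast
  have "h m \<noteq> h m'" if m: "m \<in> {\<lceil>?a\<rceil>..<\<lceil>?b\<rceil>}" "m' \<in> {\<lceil>?a\<rceil>..<\<lceil>?b\<rceil>}" "m < m'" for m m'
  proof
    assume eq: "h m = h m'"
    have "of_int m + 1 \<le> (of_int m' :: real)"
      using m(3) by linarith
    then have "2 * pi * (of_int m + 1) \<le> 2 * pi * (of_int m' :: real)"
      by (intro mult_left_mono) auto
    then have "v m + 2 * pi \<le> v m'"
      by (simp add: v_def algebra_simps)
    moreover have "v m' < dir (Suc (h m))" "dir (h m - 1) \<le> v m"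
      using h[OF m(1)] h[OF m(2)] eq by auto
    \<comment> \<open>Each step is shorter than \<open>pi\<close>, so the window is shorter than a
      full turn and cannot contain two of the angles \<open>v m\<close>.\<close>
    moreover have "dir (Suc (h m)) < dir (h m - 1) + 2 * pi"
    proof (cases "h m")
      case 0
      then show ?thesis
        using succ_dir_less[of 0] pi_gt_zero by (simp add: dir_simps del: pi_gt_zero)
    next
      case (Suc k)
      then show ?thesis
        using succ_dir_less[of "dir k"] succ_dir_less[of "dir (Suc k)"] by (simp add: dir_simps)
    qed
    ultimately show False
      by linarith
  qed
  then have "inj_on h {\<lceil>?a\<rceil>..<\<lceil>?b\<rceil>}"
    by (intro linorder_inj_onI) auto
  then have "card {\<lceil>?a\<rceil>..<\<lceil>?b\<rceil>} \<le> card ?J"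
    using h by (intro card_inj_on_le[of h]) auto
  then have "of_int (\<lceil>?b\<rceil> - \<lceil>?a\<rceil>) \<le> real (card ?J)"
    by simp
  moreover have "?b - ?a - 1 \<le> of_int (\<lceil>?b\<rceil> - \<lceil>?a\<rceil>)"
    by simp linarith
  moreover have "?b - ?a = dir n / (2 * pi)"
    by (simp add: diff_divide_distrib)
  ultimately show ?thesis
    by linarith
qed

section \<open>Integration over \<open>A\<close> and over \<open>B - A\<close>\<close>

text \<open>Integrates \<open>card_caps_inside\<close> over the interior of \<open>A\<close>, where
  each cap contributes \<open>\<alpha> * area A\<close>.\<close>

lemma cap_fraction_le_winding: "real (Suc n) * \<alpha> \<le> dir n / (2 * pi) + 2"
proof -
  let ?X = "\<lambda>j. half_minus (dir j) (t (dir j)) \<inter> A"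
  \<comment> \<open>Open caps fit \<open>card_caps_inside\<close>, which counts strict inequalities
    at interior points; only a null set is lost.\<close>
  let ?U = "\<lambda>j. interior A \<inter> {x. level (dir j) x < 0}"
  have U: "?U j \<in> lmeasurable" for j
    using open_halfspace_lt[of "lnormal (dir j)" "t (dir j)"] bounded_interior
      compact_imp_bounded[OF A_facts(1)]
    by (intro lmeasurable_open bounded_Int open_Int) (auto simp: level_def inner_commute)
  have "\<alpha> * area A \<le> area (?U j)" for j
  proof -
    have "area (?X j) \<le> area (?U j)"
    proof (rule area_le_of_negligible_diff)
      show "negligible ((A - interior A) \<union> {x. inner x (lnormal (dir j)) = t (dir j)})"
        using A_facts(6) negligible_line by (rule negligible_Un)
      show "?X j \<subseteq> ?U j \<union> ((A - interior A) \<union> {x. inner x (lnormal (dir j)) = t (dir j)})"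
        by (auto simp: half_minus_def level_def)
    qed (intro U half_minus_lmeasurable[OF A_facts(4)])+
    then show ?thesis
      by (simp add: t)
  qed
  then have "real (Suc n) * (\<alpha> * area A) \<le> (\<Sum>j\<in>{..n}. area (?U j))"
    using sum_mono[of "{..n}" "\<lambda>_. \<alpha> * area A" "\<lambda>j. area (?U j)"] by simp
  also have "\<dots> \<le> (dir n / (2 * pi) + 2) * area (interior A)"
  proof (rule sum_area_le)
    show "interior A \<in> lmeasurable"
      using bounded_interior compact_imp_bounded[OF A_facts(1)] by (intro lmeasurable_open) auto
    fix y assume y: "y \<in> interior A"
    then have "{j \<in> {..n}. y \<in> ?U j} = {j \<in> {..n}. level (dir j) y < 0}"
      by auto
    then show "real (card {j \<in> {..n}. y \<in> ?U j}) \<le> dir n / (2 * pi) + 2"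
      using card_caps_inside[OF y] by simp
  qed (use U in auto)
  also have "area (interior A) \<le> area A"
    unfolding area_def using A_facts(4) interior_subset
    by (intro measure_mono_fmeasurable) (auto intro: borel_open sets_completionI_sets)
  then have "(dir n / (2 * pi) + 2) * area (interior A) \<le> (dir n / (2 * pi) + 2) * area A"
    using dir_nonneg[of n] by (intro mult_left_mono) auto
  finally have "(real (Suc n) * \<alpha>) * area A \<le> (dir n / (2 * pi) + 2) * area A"
    by (simp only: mult.assoc)
  then show ?thesis
    using A_facts(5) by (rule mult_right_le_imp_le)
qed

text \<open>Integrates \<open>card_caps_outside\<close> over \<open>X\<close>, to be taken as
  \<open>B - A\<close>.\<close>

lemma winding_mult_area_le:
  assumes "X \<in> lmeasurable" "X \<inter> A = {}"
  shows "(dir n / (2 * pi) - 1) * area X \<le> (\<Sum>j\<le>n. area (half_minus (dir j) (t (dir j)) \<inter> X))"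
proof (rule sum_area_ge)
  fix z assume z: "z \<in> X"
  then have "{j \<in> {..n}. z \<in> half_minus (dir j) (t (dir j)) \<inter> X} = {j \<in> {..n}. level (dir j) z \<le> 0}"
    by (auto simp: mem_half_minus)
  then show "dir n / (2 * pi) - 1 \<le> real (card {j \<in> {..n}. z \<in> half_minus (dir j) (t (dir j)) \<inter> X})"
    using card_caps_outside[of z n] assms z by auto
qed (use assms half_minus_lmeasurable in auto)

text \<open>If all lines cut off too little of \<open>B\<close>, compactness of one turn gives a
  uniform deficit \<epsilon>. It falls entirely on \<open>B - A\<close>, since each line cuts off
  exactly \<open>\<alpha> * area A\<close> from \<open>A\<close>. Along the chain the total deficit
  grows linearly, while the two counts keep it bounded.\<close>

lemma exists_larger_section:
  assumes B: "planar_convex_body B" and AB: "A \<subseteq> B"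
  shows "\<exists>\<theta>. \<alpha> * area B \<le> area (half_minus \<theta> (t \<theta>) \<inter> B)"
proof (rule ccontr)
  assume *: "\<not> ?thesis"
  note B_facts = planar_convex_bodyD[OF B]
  let ?H = "\<lambda>\<theta>. area (half_minus \<theta> (t \<theta>) \<inter> B)"
  have "(\<lambda>k. t (\<phi> k)) \<longlonglongrightarrow> t \<theta>" if "\<phi> \<longlonglongrightarrow> \<theta>" for \<phi> \<theta>
    using continuous_t that by (simp add: continuous_on_eq_continuous_at isCont_tendsto_compose)
  then have "continuous_on {0..2 * pi} ?H"
    by (auto simp: continuous_on_sequentially comp_def intro!: area_half_minus_tendsto[OF B_facts(4)])
  then have "\<exists>\<mu>\<in>{0..2 * pi}. \<forall>\<theta>\<in>{0..2 * pi}. ?H \<theta> \<le> ?H \<mu>"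
    by (intro continuous_attains_sup) auto
  then obtain \<mu> where \<mu>: "\<And>\<theta>. \<theta> \<in> {0..2 * pi} \<Longrightarrow> ?H \<theta> \<le> ?H \<mu>"
    by blast
  define \<epsilon> where "\<epsilon> = \<alpha> * area B - ?H \<mu>"
  have "0 < \<epsilon>"
    using * by (simp add: \<epsilon>_def not_le)
  have H: "?H \<theta> \<le> \<alpha> * area B - \<epsilon>" for \<theta>
  proof -
    define m where "m = - \<lfloor>\<theta> / (2 * pi)\<rfloor>"
    have "of_int (- m) \<le> \<theta> / (2 * pi)" "\<theta> / (2 * pi) < of_int (- m) + 1"
      unfolding m_def by linarith+
    then have "\<theta> + 2 * pi * of_int m \<in> {0..2 * pi}"
      by (simp add: field_simps)
    moreover have "half_minus (\<theta> + 2 * pi * of_int m) s = half_minus \<theta> s" for s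
      by (simp add: half_minus_def lnormal_add_2pi_int)
    ultimately show ?thesis
      using \<mu>[of "\<theta> + 2 * pi * of_int m"] by (simp add: t_periodic \<epsilon>_def)
  qed
  let ?D = "area (B - A)"
  have D: "?D = area B - area A"
    by (rule area_Diff[OF B_facts(4) A_facts(4) AB])
  have D_nonneg: "0 \<le> ?D"
    by (simp add: area_def)
  have cap: "area (half_minus \<theta> (t \<theta>) \<inter> (B - A)) \<le> \<alpha> * ?D - \<epsilon>" for \<theta>
  proof -
    have "half_minus \<theta> (t \<theta>) \<inter> (B - A) = (half_minus \<theta> (t \<theta>) \<inter> B) - (half_minus \<theta> (t \<theta>) \<inter> A)"
      by auto
    then have "area (half_minus \<theta> (t \<theta>) \<inter> (B - A)) = ?H \<theta> - \<alpha> * area A"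
      using AB half_minus_lmeasurable[OF A_facts(4)] half_minus_lmeasurable[OF B_facts(4)] t[of \<theta>]
      by (simp only:, subst area_Diff) auto
    then show ?thesis
      using H[of \<theta>] by (simp add: D algebra_simps)
  qed
  \<comment> \<open>The 3 adds the 2 of \<open>cap_fraction_le_winding\<close> to the 1 of
    \<open>winding_mult_area_le\<close>.\<close>
  have bound: "real (Suc n) * \<epsilon> \<le> 3 * ?D" for n
  proof -
    have "(real (Suc n) * \<alpha> - 3) * ?D \<le> (dir n / (2 * pi) - 1) * ?D"
      using cap_fraction_le_winding[of n] D_nonneg by (intro mult_right_mono) auto
    also have "\<dots> \<le> (\<Sum>j\<le>n. area (half_minus (dir j) (t (dir j)) \<inter> (B - A)))"
      using A_facts(4) B_facts(4) by (intro winding_mult_area_le) (auto intro: fmeasurable.Diff)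
    also have "\<dots> \<le> real (Suc n) * (\<alpha> * ?D - \<epsilon>)"
      using sum_mono[of "{..n}" _ "\<lambda>_. \<alpha> * ?D - \<epsilon>"] cap by fastforce
    finally show ?thesis
      by (simp add: algebra_simps)
  qed
  obtain n where "3 * ?D < real n * \<epsilon>"
    using \<open>0 < \<epsilon>\<close> reals_Archimedean3 by blast
  then show False
    using bound[of n] \<open>0 < \<epsilon>\<close> by (simp add: algebra_simps)
qed

end

theorem theorem1:
  fixes A B :: "(real^2) set" and \<alpha> :: real
  assumes "planar_convex_body A" and "planar_convex_body B" and "A \<subseteq> B"
    and "0 < \<alpha>" and "\<alpha> < 1/2"
  shows "\<exists>\<theta> t \<beta>. is_section \<alpha> A \<theta> t \<and> is_section \<beta> B \<theta> t \<and> \<beta> \<ge> \<alpha>"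
proof -
  have "\<exists>t. \<forall>\<theta>. area (half_minus \<theta> (t \<theta>) \<inter> A) = \<alpha> * area A"
    using exists_section[OF assms(1)] assms(4,5) by (intro choice) simp
  then obtain t where t: "\<And>\<theta>. area (half_minus \<theta> (t \<theta>) \<inter> A) = \<alpha> * area A"
    by blast
  interpret equal_area_caps A \<alpha> t
    by unfold_locales (use assms t in auto)
  obtain \<theta> where \<theta>: "\<alpha> * area B \<le> area (half_minus \<theta> (t \<theta>) \<inter> B)"
    using exists_larger_section assms by blast
  note B_facts = planar_convex_bodyD[OF assms(2)]
  define \<beta> where "\<beta> = area (half_minus \<theta> (t \<theta>) \<inter> B) / area B"
  \<comment> \<open>\<open>is_section\<close> demands \<beta> < 1: the part of \<open>A\<close> left
    of the line has positive area and lies in the part of \<open>B\<close> left of it.\<close>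
  have "area (A - (half_minus \<theta> (t \<theta>) \<inter> A)) = area A - \<alpha> * area A"
    using A_facts(4) half_minus_lmeasurable[OF A_facts(4)] t by (subst area_Diff) auto
  then have "0 < area (A - (half_minus \<theta> (t \<theta>) \<inter> A))"
    using cap_area_bounds by simp
  also have "\<dots> \<le> area (B - (half_minus \<theta> (t \<theta>) \<inter> B))"
    unfolding area_def using assms(3) A_facts(4) B_facts(4) half_minus_lmeasurable
    by (intro measure_mono_fmeasurable) (auto intro!: fmeasurable.Diff fmeasurableD)
  also have "\<dots> = area B - area (half_minus \<theta> (t \<theta>) \<inter> B)"
    using B_facts(4) half_minus_lmeasurable[OF B_facts(4)] by (subst area_Diff) auto
  finally have "\<alpha> \<le> \<beta>" "\<beta> < 1" "area (half_minus \<theta> (t \<theta>) \<inter> B) = \<beta> * area B"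
    using \<theta> B_facts(5) by (simp_all add: \<beta>_def field_simps)
  then have "is_section \<alpha> A \<theta> (t \<theta>) \<and> is_section \<beta> B \<theta> (t \<theta>) \<and> \<beta> \<ge> \<alpha>"
    using assms t by (simp add: is_section_def)
  then show ?thesis
    by blast
qed

end
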